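(* Let $H$ be a $\mathcal{PH}$-graph, let $F_1,\ldots,F_t\subseteq V_{\mathcal H}(H)$ ($t\geq 1$), let $G=H\square_{F_1,\ldots,F_t}K_2^{\square t}$ and let $(G,p,\ell)$ be a point-hyperplane framework in $\mathbb{R}^d$ with $t$-fold extrusion symmetry and extrusion directions $\tau_1,\ldots,\tau_t$. Let $\Gamma=\mathbb{Z}_2^t$ and let $\theta:\Gamma\to\mathrm{Aut}(G)$ be the extrusion action. Suppose there is no edge $\{i,j\}\in E_{\mathcal{PH}}$ (with $i\in V_{\mathcal P}$, $j\in V_{\mathcal H}$) where the hyperplane corresponding to $j$ contains an extrusion direction. Then the point-hyperplane rigidity matrix satisfies $R(G,p,\ell)\in\mathrm{Hom}_\Gamma(P'_V,P'_E)$, i.e. $R(G,p,\ell)\,P'_V(\gamma)=P'_E(\gamma)\,R(G,p,\ell)$ for all $\gamma\in\Gamma$, where $P'_V$ and $P'_E$ are the external and internal representations of $\Gamma$.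
   Context: **Frameworks.** A $\mathcal{PH}$-graph is a finite simple graph $G=(V_{\mathcal P}\cup V_{\mathcal H},E)$ with vertex set partitioned into non-empty sets $V_{\mathcal P},V_{\mathcal H}$; $E$ is partitioned into $E_{\mathcal{PP}},E_{\mathcal{PH}},E_{\mathcal{HH}}$ according to the types of the end-vertices. A point-hyperplane framework $(G,p,\ell)$ in $\mathbb{R}^d$ has maps $p:V_{\mathcal P}\to\mathbb{R}^d$ and $\ell=(a,r):V_{\mathcal H}\to(\mathbb{R}^d\setminus\{0\})\times\mathbb{R}$; vertex $j\in V_{\mathcal H}$ represents the hyperplane $\{x:\langle a_j,x\rangle=r_j\}$, which contains a direction $\tau$ if $\langle a_j,\tau\rangle=0$. $E_{\mathcal{HH}}$ is split into $E_{\mathcal{HH}\parallel}$ (edges whose two hyperplanes are parallel) and $E_{\mathcal{HH}\not\parallel}$ (the others). **Graph.** $H\square K_2^{\square t}$ has vertices $(u,\mathbf e)$, $u\in V(H)$, $\mathbf e\in\{0,1\}^t$, and edges $\{(u,\mathbf e),(u',\mathbf e)\}$ for $\{u,u'\}\in E(H)$ and $\{(u,\mathbf e),(u,\mathbf e')\}$ for $\mathbf e,\mathbf e'$ differing in exactly one entry. $G=H\square_{F_1,\ldots,F_t}K_2^{\square t}$ is obtained from it by contracting, for $h=1,\dots,t$ and $w\in F_h$, all pairs $(w,\mathbf e),(w,\mathbf e')$ with $\mathbf e,\mathbf e'$ differing only in the $h$-th entry to one vertex, whose $h$-th entry is then written $\star$; edges between contracted vertices are removed (and multiple edges are identified). So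 its vertices are $(u,\mathbf e)$ with $\mathbf e\in\{0,1,\star\}^t$, where $\mathbf e_h=\star$ iff $u\in F_h$. A vertex $(u,\mathbf e)$ is in $V_{\mathcal P}$ (resp. $V_{\mathcal H}$) iff $u\in V_{\mathcal P}(H)$ (resp. $V_{\mathcal H}(H)$). The extrusion action is $\theta(\gamma)(u,\mathbf e)=(u,\mathbf e+\gamma)$, addition mod 2 with $\star+0=\star+1=\star$; write $\gamma i$ for $\theta(\gamma)(i)$ and $\gamma e$ for the induced action on edges. **Extrusion symmetry.** For a vertex $i=(u,\mathbf e)$ and $\gamma\in\Gamma$ put $\tau_\gamma(i)=\sum_{h\in X}\tau_h-\sum_{g\in Y}\tau_g$, where $X=\{h:\mathbf e_h=0,\gamma_h=1\}$ and $Y=\{g:\mathbf e_g=1,\gamma_g=1\}$. $(G,p,\ell)$ has $t$-fold extrusion symmetry with extrusion directions $\tau_1,\ldots,\tau_t\in\mathbb{R}^d\setminus\{0\}$ if for all $\gamma\in\Gamma$: (i) $p_{\gamma i}=p_i+\tau_\gamma(i)$ for $i\in V_{\mathcal P}$; (ii) $a_{\gamma j}=a_j$ for $j\in V_{\mathcal H}$; (iii) $\langle\tau_h,a_{(w,\mathbf e)}\rangle=0$ for $(w,\mathbf e)\in V_{\mathcal H}$ whenever $w\in F_h$; (iv) $r_{\gamma j}=r_j+\langle a_j,\tau_\gamma(j)\rangle$ for $j\in V_{\mathcal H}$. **Rigidity matrix.** $R(G,p,\ell)$ has $d$ columns for each $i\in V_{\mathcal P}$ (variables $\dot p_i$) and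 $d+1$ columns for each $j\in V_{\mathcal H}$ (variables $\dot\ell_j=(\dot a_j,\dot r_j)$). Its rows, in this order, with entries zero where not specified, are: for $\{i,j\}\in E_{\mathcal{PP}}$: $p_i-p_j$ under $i$ and $p_j-p_i$ under $j$; for $\{i,k\}\in E_{\mathcal{PH}}$: $a_k$ under $i$ and $(p_i,-1)$ under $k$; for $\{k,l\}\in E_{\mathcal{HH}\not\parallel}$: $(a_l,0)$ under $k$ and $(a_k,0)$ under $l$; for $\{k,l\}\in E_{\mathcal{HH}\parallel}$: $d-1$ rows, the $m$-th being $(c\,\alpha_m,0)$ under $k$ and $(-\alpha_m,0)$ under $l$, where $a_l=c\,a_k$ and $\alpha_1,\ldots,\alpha_{d-1}$ is a basis of the orthogonal complement of $a_k$ in $\mathbb{R}^d$; for each $k\in V_{\mathcal H}$: $(a_k,0)$ under $k$. Conventions for parallel edges: for $\{(w,\mathbf e),(w,\mathbf e')\}$ with $\mathbf e_h=0$, $\mathbf e'_h=1$, take $k=(w,\mathbf e)$, $l=(w,\mathbf e')$ (here $c=1$); for edges whose end-vertices lie over distinct vertices of $H$, the vertex taken as $k$ lies over the same vertex of $H$ for all edges of a $\Gamma$-orbit; and the same vectors $\alpha_m$ are used for all edges in a $\Gamma$-orbit. **Representations.** $P_S$ denotes the permutation representation of $\Gamma$ on a set $S$, with $P_S(\gamma)=[\delta_{x,\gamma y}]_{x,y\in S}$. The internal representation is $P'_E=P'_{E_{\mathcal{PP}}}\oplus P_{E_{\mathcal{PH}}}\oplus P_{E_{\mathcal{HH}\not\parallel}}\oplus(P'_{E_{\mathcal{HH}\parallel}}\otimes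 I_{d-1})\oplus P_{V_{\mathcal H}}$, acting on the row space of coordinates. Here $P'_{E_{\mathcal{PP}}}$ and $P'_{E_{\mathcal{HH}\parallel}}$ are obtained from $P_{E_{\mathcal{PP}}}$ and $P_{E_{\mathcal{HH}\parallel}}$ as follows: for each $\gamma$ and each edge $e=\{(u,\mathbf e),(u,\mathbf e')\}$ with $\mathbf e,\mathbf e'$ differing exactly in the $h$-th entry, with $f=\gamma e$, the $1$ in the $(e,f)$ and $(f,e)$ entries is replaced by $-1$ iff $\gamma_h=1$. The external representation is $P'_V=(P_{V_{\mathcal P}}\otimes I_d)\oplus P'_{V_{\mathcal H}}$ on $\mathbb{R}^{d|V_{\mathcal P}|+(d+1)|V_{\mathcal H}|}$, where $P'_{V_{\mathcal H}}(\gamma)$ is obtained from $P_{V_{\mathcal H}}(\gamma)=[\delta_{i,\gamma j}]_{i,j}$ by replacing each $0$ by the $(d+1)\times(d+1)$ zero matrix and each $1$ in entry $(i,j)$ by $\begin{pmatrix}I_d&\mathbf 0\\-\tau_\gamma(i)^T&1\end{pmatrix}$. For representations $\rho_1,\rho_2$ of $\Gamma$ on $X,Y$, $\mathrm{Hom}_\Gamma(\rho_1,\rho_2)$ is the space of linear maps $T:X\to Y$ with $T\rho_1(\gamma)=\rho_2(\gamma)T$ for all $\gamma$. *)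

theory Defs
  imports
    "HOL-Library.Z2"
    "HOL-Analysis.Analysis"
    "Jordan_Normal_Form.Matrix"
begin

no_notation Matrix.vec_index (infixl "$" 100)
no_notation Matrix.scalar_prod (infix "\<bullet>" 70)

section \<open>Graphs with point and hyperplane vertices\<close>

record 'v ph_graph =
  VP :: "'v set"
  VH :: "'v set"
  edges :: "'v set set"

definition ph_graph :: "'v ph_graph \<Rightarrow> bool" where
  "ph_graph G \<longleftrightarrow>
     finite (VP G) \<and> finite (VH G) \<and> VP G \<noteq> {} \<and> VH G \<noteq> {} \<and> VP G \<inter> VH G = {} \<and>
     (\<forall>e \<in> edges G. e \<subseteq> VP G \<union> VH G \<and> card e = 2)"

definition E_PP :: "'v ph_graph \<Rightarrow> 'v set set" where
  "E_PP G = {e \<in> edges G. e \<subseteq> VP G}"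

definition E_PH :: "'v ph_graph \<Rightarrow> 'v set set" where
  "E_PH G = {e \<in> edges G. e \<inter> VP G \<noteq> {} \<and> e \<inter> VH G \<noteq> {}}"

definition E_HH :: "'v ph_graph \<Rightarrow> 'v set set" where
  "E_HH G = {e \<in> edges G. e \<subseteq> VH G}"

text \<open>The end-vertex of the edge \<open>e\<close> other than \<open>v\<close>.\<close>

definition other_end :: "'v set \<Rightarrow> 'v \<Rightarrow> 'v" where
  "other_end e v = (THE w. e = {v, w})"

section \<open>Extrusion graphs\<close>

text \<open>
  The coordinates of the cube and the extrusion directions are indexed by a finite type
  \<open>'t\<close>, so that \<open>t = CARD('t) \<ge> 1\<close>, and the group \<open>\<Gamma>\<close> is the additive group of \<open>bit ^ 't\<close>.
  In the second component of a vertex, \<open>None\<close> stands for the entry \<open>\<star>\<close>.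
\<close>

type_synonym ('u, 't) xvertex = "'u \<times> (bit option ^ 't)"

definition differ_at :: "'t \<Rightarrow> 'a ^ 't \<Rightarrow> 'a ^ 't \<Rightarrow> bool" where
  "differ_at h x y \<longleftrightarrow> {g. x $ g \<noteq> y $ g} = {h}"

definition cube_product :: "'u ph_graph \<Rightarrow> ('u \<times> (bit ^ ('t::finite))) ph_graph" where
  "cube_product H =
     \<lparr>VP = VP H \<times> UNIV, VH = VH H \<times> UNIV,
      edges = {{(u, x), (v, x)} |u v x. {u, v} \<in> edges H} \<union>
              {{(u, x), (u, y)} |u x y h. u \<in> VP H \<union> VH H \<and> differ_at h x y}\<rparr>"

text \<open>
  Two vertices of the cube product are contracted to one iff they have the same image under this map,
  i.e. iff they are joined by a chain of pairs \<open>(w, x)\<close>, \<open>(w, y)\<close> where \<open>x\<close> and \<open>y\<close> differ only in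
  an entry \<open>h\<close> with \<open>w \<in> F h\<close>. Edges on which it is not injective would become loops.
\<close>

definition contraction :: "('t::finite \<Rightarrow> 'u set) \<Rightarrow> 'u \<times> (bit ^ 't) \<Rightarrow> ('u, 't) xvertex" where
  "contraction F = (\<lambda>(u, x). (u, \<chi> h. if u \<in> F h then None else Some (x $ h)))"

definition extrusion_graph :: "'u ph_graph \<Rightarrow> ('t::finite \<Rightarrow> 'u set) \<Rightarrow> ('u, 't) xvertex ph_graph" where
  "extrusion_graph H F =
     \<lparr>VP = contraction F ` VP (cube_product H), VH = contraction F ` VH (cube_product H),
      edges = {contraction F ` e |e. e \<in> edges (cube_product H) \<and> inj_on (contraction F) e}\<rparr>"

definition extrude :: "bit ^ ('t::finite) \<Rightarrow> ('u, 't) xvertex \<Rightarrow> ('u, 't) xvertex" where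
  "extrude \<gamma> = (\<lambda>(u, x). (u, \<chi> h. map_option (\<lambda>b. b + \<gamma> $ h) (x $ h)))"

section \<open>Point-hyperplane frameworks with extrusion symmetry\<close>

text \<open>\<open>\<real>\<^sup>d\<close> is \<open>real ^ 'd\<close>, and \<open>L j = (a\<^sub>j, r\<^sub>j)\<close> represents the hyperplane of \<open>j\<close>.\<close>

definition framework ::
  "'v ph_graph \<Rightarrow> ('v \<Rightarrow> real ^ 'd) \<Rightarrow> ('v \<Rightarrow> (real ^ 'd) \<times> real) \<Rightarrow> bool" where
  "framework G p L \<longleftrightarrow> ph_graph G \<and> (\<forall>j \<in> VH G. fst (L j) \<noteq> 0)"

definition hyperplane :: "(real ^ 'd) \<times> real \<Rightarrow> (real ^ 'd) set" where
  "hyperplane ar = {x. fst ar \<bullet> x = snd ar}"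

definition contains_direction :: "(real ^ 'd) \<times> real \<Rightarrow> real ^ 'd \<Rightarrow> bool" where
  "contains_direction ar \<tau> \<longleftrightarrow> fst ar \<bullet> \<tau> = 0"

definition E_HH_par :: "'v ph_graph \<Rightarrow> ('v \<Rightarrow> (real ^ 'd) \<times> real) \<Rightarrow> 'v set set" where
  "E_HH_par G L =
     {e \<in> E_HH G. \<forall>k l. e = {k, l} \<longrightarrow> affine_parallel (hyperplane (L k)) (hyperplane (L l))}"

definition E_HH_npar :: "'v ph_graph \<Rightarrow> ('v \<Rightarrow> (real ^ 'd) \<times> real) \<Rightarrow> 'v set set" where
  "E_HH_npar G L = E_HH G - E_HH_par G L"

definition shift :: "('t \<Rightarrow> real ^ 'd) \<Rightarrow> bit ^ 't \<Rightarrow> ('u, 't::finite) xvertex \<Rightarrow> real ^ 'd" where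
  "shift \<tau> \<gamma> i = (\<Sum>h | snd i $ h = Some 0 \<and> \<gamma> $ h = 1. \<tau> h)
                - (\<Sum>g | snd i $ g = Some 1 \<and> \<gamma> $ g = 1. \<tau> g)"

definition extrusion_symmetric ::
  "('u, 't::finite) xvertex ph_graph \<Rightarrow> ('t \<Rightarrow> 'u set) \<Rightarrow> (('u, 't) xvertex \<Rightarrow> real ^ 'd) \<Rightarrow>
   (('u, 't) xvertex \<Rightarrow> (real ^ 'd) \<times> real) \<Rightarrow> ('t \<Rightarrow> real ^ 'd) \<Rightarrow> bool" where
  "extrusion_symmetric G F p L \<tau> \<longleftrightarrow>
     (\<forall>h. \<tau> h \<noteq> 0) \<and>
     (\<forall>\<gamma>. \<forall>i \<in> VP G. p (extrude \<gamma> i) = p i + shift \<tau> \<gamma> i) \<and>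
     (\<forall>\<gamma>. \<forall>j \<in> VH G. fst (L (extrude \<gamma> j)) = fst (L j)) \<and>
     (\<forall>h. \<forall>j \<in> VH G. fst j \<in> F h \<longrightarrow> \<tau> h \<bullet> fst (L j) = 0) \<and>
     (\<forall>\<gamma>. \<forall>j \<in> VH G. snd (L (extrude \<gamma> j)) = snd (L j) + fst (L j) \<bullet> shift \<tau> \<gamma> j)"

section \<open>The rigidity matrix\<close>

text \<open>
  Rows and columns carry labels, and \<open>labelled_mat rs cs M\<close> lists them in the order given by \<open>rs\<close>
  and \<open>cs\<close>. A parallel edge \<open>e\<close> has the rows \<open>Row_HH_par e m\<close> for \<open>m < d - 1\<close>. The columns \<open>Col_p i n\<close>
  and \<open>Col_a j n\<close> belong to the \<open>n\<close>-th coordinates of the velocities of \<open>p\<^sub>i\<close> and \<open>a\<^sub>j\<close>, the column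
  \<open>Col_r j\<close> to the velocity of \<open>r\<^sub>j\<close>.
\<close>

datatype 'v row_label =
  Row_PP "'v set" | Row_PH "'v set" | Row_HH_npar "'v set" | Row_HH_par "'v set" nat | Row_VH 'v

datatype ('v, 'd) col_label = Col_p 'v 'd | Col_a 'v 'd | Col_r 'v

definition row_labels :: "'v ph_graph \<Rightarrow> ('v \<Rightarrow> (real ^ 'd) \<times> real) \<Rightarrow> 'v row_label set" where
  "row_labels G L =
     Row_PP ` E_PP G \<union> Row_PH ` E_PH G \<union> Row_HH_npar ` E_HH_npar G L \<union>
     {Row_HH_par e m |e m. e \<in> E_HH_par G L \<and> m < CARD('d) - 1} \<union> Row_VH ` VH G"

definition col_labels :: "'v ph_graph \<Rightarrow> ('v, 'd) col_label set" where
  "col_labels G = {Col_p i n |i n. i \<in> VP G} \<union> {Col_a j n |j n. j \<in> VH G} \<union> Col_r ` VH G"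

definition labelled_mat :: "'r list \<Rightarrow> 'c list \<Rightarrow> ('r \<Rightarrow> 'c \<Rightarrow> real) \<Rightarrow> real mat" where
  "labelled_mat rs cs M = Matrix.mat (length rs) (length cs) (\<lambda>(m, n). M (rs ! m) (cs ! n))"

definition enumerates :: "'a list \<Rightarrow> 'a set \<Rightarrow> bool" where
  "enumerates xs S \<longleftrightarrow> distinct xs \<and> set xs = S"

text \<open>
  The rows of a parallel edge \<open>e\<close> depend on the end-vertex \<open>\<kappa> e\<close> playing the role of \<open>k\<close> and
  on the basis \<open>\<alpha> e 0, \<dots>, \<alpha> e (d - 2)\<close> of the orthogonal complement of its normal vector.
\<close>

definition parallel_conventions ::
  "('u, 't::finite) xvertex ph_graph \<Rightarrow> (('u, 't) xvertex \<Rightarrow> (real ^ 'd) \<times> real) \<Rightarrow>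
   (('u, 't) xvertex set \<Rightarrow> ('u, 't) xvertex) \<Rightarrow>
   (('u, 't) xvertex set \<Rightarrow> nat \<Rightarrow> real ^ 'd) \<Rightarrow> bool" where
  "parallel_conventions G L \<kappa> \<alpha> \<longleftrightarrow>
     (\<forall>e \<in> E_HH_par G L.
        \<kappa> e \<in> e \<and>
        (\<forall>w x y h. e = {(w, x), (w, y)} \<and> differ_at h x y \<and> x $ h = Some 0 \<and> y $ h = Some 1
           \<longrightarrow> \<kappa> e = (w, x)) \<and>
        (inj_on fst e \<longrightarrow> (\<forall>\<gamma>. fst (\<kappa> (extrude \<gamma> ` e)) = fst (\<kappa> e))) \<and>
        inj_on (\<alpha> e) {..<CARD('d) - 1} \<and> independent (\<alpha> e ` {..<CARD('d) - 1}) \<and>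
        span (\<alpha> e ` {..<CARD('d) - 1}) = {fst (L (\<kappa> e))}\<^sup>\<bottom> \<and>
        (\<forall>\<gamma>. \<forall>m < CARD('d) - 1. \<alpha> (extrude \<gamma> ` e) m = \<alpha> e m))"

fun rigidity_entry ::
  "('v \<Rightarrow> real ^ 'd) \<Rightarrow> ('v \<Rightarrow> (real ^ 'd) \<times> real) \<Rightarrow> ('v set \<Rightarrow> 'v) \<Rightarrow> ('v set \<Rightarrow> nat \<Rightarrow> real ^ 'd) \<Rightarrow>
   'v row_label \<Rightarrow> ('v, 'd) col_label \<Rightarrow> real" where
  "rigidity_entry p L \<kappa> \<alpha> (Row_PP e) (Col_p i n) =
     (if i \<in> e then (p i - p (other_end e i)) $ n else 0)"
| "rigidity_entry p L \<kappa> \<alpha> (Row_PH e) (Col_p i n) =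
     (if i \<in> e then fst (L (other_end e i)) $ n else 0)"
| "rigidity_entry p L \<kappa> \<alpha> (Row_PH e) (Col_a k n) =
     (if k \<in> e then p (other_end e k) $ n else 0)"
| "rigidity_entry p L \<kappa> \<alpha> (Row_PH e) (Col_r k) = (if k \<in> e then - 1 else 0)"
| "rigidity_entry p L \<kappa> \<alpha> (Row_HH_npar e) (Col_a k n) =
     (if k \<in> e then fst (L (other_end e k)) $ n else 0)"
| "rigidity_entry p L \<kappa> \<alpha> (Row_HH_par e m) (Col_a v n) =
     (if v \<notin> e then 0
      else if v = \<kappa> e
      then (THE c. fst (L (other_end e (\<kappa> e))) = c *\<^sub>R fst (L (\<kappa> e))) * \<alpha> e m $ n
      else - \<alpha> e m $ n)"
| "rigidity_entry p L \<kappa> \<alpha> (Row_VH k) (Col_a j n) = (if j = k then fst (L k) $ n else 0)"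
| "rigidity_entry p L \<kappa> \<alpha> _ _ = 0"

section \<open>Representations\<close>

text \<open>
  Representations of the additive group of the type \<open>'g\<close> on \<open>\<real>\<^sup>n\<close> are given by their matrices,
  and linear maps \<open>\<real>\<^sup>n \<rightarrow> \<real>\<^sup>m\<close> are \<open>m \<times> n\<close> matrices.
\<close>

definition Hom_rep ::
  "nat \<Rightarrow> ('g::group_add \<Rightarrow> real mat) \<Rightarrow> nat \<Rightarrow> ('g \<Rightarrow> real mat) \<Rightarrow> real mat set" where
  "Hom_rep n \<rho>\<^sub>1 m \<rho>\<^sub>2 = {T \<in> carrier_mat m n. \<forall>\<gamma>. T * \<rho>\<^sub>1 \<gamma> = \<rho>\<^sub>2 \<gamma> * T}"

definition perm_entry :: "('g \<Rightarrow> 's \<Rightarrow> 's) \<Rightarrow> 'g \<Rightarrow> 's \<Rightarrow> 's \<Rightarrow> real" where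
  "perm_entry act \<gamma> x y = (if x = act \<gamma> y then 1 else 0)"

definition signed_perm_entry ::
  "bit ^ ('t::finite) \<Rightarrow> ('u, 't) xvertex set \<Rightarrow> ('u, 't) xvertex set \<Rightarrow> real" where
  "signed_perm_entry \<gamma> e f =
     (if \<exists>u x y h. e = {(u, x), (u, y)} \<and> differ_at h x y \<and> \<gamma> $ h = 1 then - 1 else 1) *
     perm_entry (\<lambda>\<gamma> e. extrude \<gamma> ` e) \<gamma> e f"

fun internal_entry ::
  "bit ^ ('t::finite) \<Rightarrow> ('u, 't) xvertex row_label \<Rightarrow> ('u, 't) xvertex row_label \<Rightarrow> real" where
  "internal_entry \<gamma> (Row_PP e) (Row_PP f) = signed_perm_entry \<gamma> e f"
| "internal_entry \<gamma> (Row_PH e) (Row_PH f) = perm_entry (\<lambda>\<gamma> e. extrude \<gamma> ` e) \<gamma> e f"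
| "internal_entry \<gamma> (Row_HH_npar e) (Row_HH_npar f) = perm_entry (\<lambda>\<gamma> e. extrude \<gamma> ` e) \<gamma> e f"
| "internal_entry \<gamma> (Row_HH_par e m) (Row_HH_par f n) =
     signed_perm_entry \<gamma> e f * (if m = n then 1 else 0)"
| "internal_entry \<gamma> (Row_VH j) (Row_VH k) = perm_entry extrude \<gamma> j k"
| "internal_entry \<gamma> _ _ = 0"

fun external_entry ::
  "('t::finite \<Rightarrow> real ^ 'd) \<Rightarrow> bit ^ 't \<Rightarrow>
   (('u, 't) xvertex, 'd) col_label \<Rightarrow> (('u, 't) xvertex, 'd) col_label \<Rightarrow> real" where
  "external_entry \<tau> \<gamma> (Col_p i m) (Col_p j n) =
     perm_entry extrude \<gamma> i j * (if m = n then 1 else 0)"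
| "external_entry \<tau> \<gamma> (Col_a i m) (Col_a j n) =
     perm_entry extrude \<gamma> i j * (if m = n then 1 else 0)"
| "external_entry \<tau> \<gamma> (Col_r i) (Col_a j n) = perm_entry extrude \<gamma> i j * (- shift \<tau> \<gamma> i $ n)"
| "external_entry \<tau> \<gamma> (Col_r i) (Col_r j) = perm_entry extrude \<gamma> i j"
| "external_entry \<tau> \<gamma> _ _ = 0"

end

theory Submission
  imports Defs
begin

text \<open>
  Each \<open>\<gamma>\<close> permutes the row labels up to sign, and the claim amounts to the entry-wise invariance of
  the rigidity matrix under this action. An edge of \<open>G\<close> is either a copy of an edge of \<open>H\<close> or joins
  a vertex to its image under the generator of some factor \<open>h\<close>. If \<open>\<gamma>\<^sub>h = 1\<close>, then
  \<open>\<gamma>\<close> interchanges the roles of the two end-vertices of an edge of the second kind, which accounts for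
  the signs in the internal representation. On a copy of a point-point or point-hyperplane edge of
  \<open>H\<close> no entry \<open>\<star>\<close> occurs, because a hyperplane with an entry \<open>\<star>\<close> contains an extrusion direction;
  hence \<open>\<gamma>\<close> shifts both of its end-vertices by the same vector.
\<close>

section \<open>Matrices with labelled rows and columns\<close>

text \<open>Distinctness of \<open>cs\<close> turns the sum over positions into a sum over labels,
  so that later computations never mention positions.\<close>

lemma labelled_mat_mult:
  fixes cs :: "'a list"
  assumes "distinct cs"
  shows "labelled_mat rs cs M * labelled_mat cs ds N =
         labelled_mat rs ds (\<lambda>r d. \<Sum>c \<in> set cs. M r c * N c d)"
proof -
  have "(\<Sum>i = 0..<length cs. f (cs ! i)) = (\<Sum>c \<in> set cs. f c)" for f :: "'a \<Rightarrow> real"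
    using assms by (simp add: sum.distinct_set_conv_list sum_list_sum_nth)
  then show ?thesis
    by (intro eq_matI) (simp_all add: labelled_mat_def scalar_prod_def)
qed

lemma labelled_mat_cong:
  assumes "\<And>r c. r \<in> set rs \<Longrightarrow> c \<in> set cs \<Longrightarrow> M r c = N r c"
  shows "labelled_mat rs cs M = labelled_mat rs cs N"
  using assms by (auto simp: labelled_mat_def intro!: eq_matI)

section \<open>The extrusion action\<close>

lemma bit_double [simp]: "(b::bit) + c + c = b"
  by (cases b; cases c) simp_all

lemma fst_extrude [simp]: "fst (extrude \<gamma> i) = fst i"
  by (simp add: extrude_def split_beta)

lemma extrude_extrude [simp]: "extrude \<gamma> (extrude \<gamma> i) = i"
proof -
  have "map_option (\<lambda>b. b + c) (map_option (\<lambda>b. b + c) z) = z" for c and z :: "bit option"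
    by (cases z) (simp_all only: option.map bit_double)
  then show ?thesis
    by (simp add: extrude_def split_beta Finite_Cartesian_Product.vec_eq_iff prod_eq_iff del: bit_double)
qed

lemma extrude_eq_iff [simp]: "extrude \<gamma> i = extrude \<gamma> j \<longleftrightarrow> i = j"
  by (metis extrude_extrude)

lemma extrude_image_image [simp]: "extrude \<gamma> ` extrude \<gamma> ` e = e"
  by (simp add: image_image)

lemma extrude_mem_image [simp]: "extrude \<gamma> v \<in> extrude \<gamma> ` e \<longleftrightarrow> v \<in> e"
  by auto

text \<open>On representatives in the cube, \<Gamma> acts by plain addition; computing with them
  avoids case distinctions on starred entries.\<close>

lemma extrude_contraction [simp]:
  "extrude \<gamma> (contraction F (u, x)) = contraction F (u, x + \<gamma>)"
  by (simp add: extrude_def contraction_def Finite_Cartesian_Product.vec_eq_iff)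

lemma fst_contraction [simp]: "fst (contraction F (u, x)) = u"
  by (simp add: contraction_def)

lemma bit_vec_double [simp]: "(x :: bit ^ 't) + y + y = x"
  by (simp add: Finite_Cartesian_Product.vec_eq_iff)

text \<open>Over the two-element field, changing exactly one entry means adding a unit vector. Cube
  edges in direction \<open>h\<close> thus join a vertex to its image under the generator
  \<open>axis h 1\<close>.\<close>

lemma differ_at_bit: "differ_at h x y \<longleftrightarrow> y = x + axis h (1::bit)"
proof -
  have *: "(b \<noteq> c) = P \<longleftrightarrow> c = b + (if P then 1 else 0)" for b c :: bit and P
    by (cases b; cases c; cases P) simp_all
  have "differ_at h x y \<longleftrightarrow> (\<forall>g. (x $ g \<noteq> y $ g) = (g = h))"
    unfolding differ_at_def by blast
  then show ?thesis
    by (simp only: * Finite_Cartesian_Product.vec_eq_iff vector_add_component axis_def vec_lambda_beta)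
qed

lemma contraction_flip_eq_iff:
  "contraction F (u, x) = contraction F (u, x + axis h 1) \<longleftrightarrow> u \<in> F h"
  by (auto simp: contraction_def Finite_Cartesian_Product.vec_eq_iff axis_def)

text \<open>The two vectors agree away from \<open>h\<close>, stars included, so an edge between
  copies of one vertex determines its direction and hence its sign.\<close>

lemma differ_at_contraction_flip:
  assumes "u \<notin> F h"
  shows "differ_at g (snd (contraction F (u, x))) (snd (contraction F (u, x + axis h 1))) \<longleftrightarrow> g = h"
proof -
  have "{k. snd (contraction F (u, x)) $ k \<noteq> snd (contraction F (u, x + axis h 1)) $ k} = {h}"
    using assms by (auto simp: contraction_def axis_def split: if_splits)
  then show ?thesis
    by (auto simp: differ_at_def)
qed

lemma differ_at_commute: "differ_at h x y \<longleftrightarrow> differ_at h y x"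
  by (simp add: differ_at_def eq_commute)

text \<open>Starred entries contribute to neither sum of the definition, so both merge into one
  signed sum over all directions in which stars appear only through membership in
  \<open>F h\<close>.\<close>

lemma shift_eq_sum:
  "shift \<tau> \<gamma> (contraction F (u, x)) =
     (\<Sum>h\<in>UNIV. if u \<notin> F h \<and> \<gamma> $ h = 1 then (if x $ h = 0 then \<tau> h else - \<tau> h) else 0)"
proof -
  have "shift \<tau> \<gamma> (contraction F (u, x)) =
     (\<Sum>h\<in>UNIV. if snd (contraction F (u, x)) $ h = Some 0 \<and> \<gamma> $ h = 1 then \<tau> h else 0) -
     (\<Sum>h\<in>UNIV. if snd (contraction F (u, x)) $ h = Some 1 \<and> \<gamma> $ h = 1 then \<tau> h else 0)"
    unfolding shift_def by (simp add: sum.If_cases)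
  then show ?thesis
    by (auto simp: sum_subtractf[symmetric] contraction_def intro!: sum.cong)
qed

lemma shift_axis:
  assumes "u \<notin> F h"
  shows "shift \<tau> (axis h 1) (contraction F (u, x)) = (if x $ h = 0 then \<tau> h else - \<tau> h)"
proof -
  have "shift \<tau> (axis h 1) (contraction F (u, x)) =
      (\<Sum>g\<in>UNIV. if g = h then (if x $ h = 0 then \<tau> h else - \<tau> h) else 0)"
    unfolding shift_eq_sum using assms by (intro sum.cong) (auto simp: axis_def)
  then show ?thesis
    by simp
qed

text \<open>Without stars, nothing in the signed sum refers to the vertex of
  \<open>H\<close>.\<close>

lemma shift_cong_unstarred:
  assumes "\<And>h. u \<notin> F h" "\<And>h. v \<notin> F h"
  shows "shift \<tau> \<gamma> (contraction F (u, x)) = shift \<tau> \<gamma> (contraction F (v, x))"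
  using assms by (simp add: shift_eq_sum)

text \<open>The sign in \<open>signed_perm_entry\<close>, split off from the permutation
  matrix.\<close>

definition edge_sign :: "bit ^ ('t::finite) \<Rightarrow> ('u, 't) xvertex set \<Rightarrow> real" where
  "edge_sign \<gamma> e =
     (if \<exists>u x y h. e = {(u, x), (u, y)} \<and> differ_at h x y \<and> \<gamma> $ h = 1 then - 1 else 1)"

lemma edge_sign_transversal:
  assumes "fst v \<noteq> fst w"
  shows "edge_sign \<gamma> {v, w} = 1"
  using assms by (force simp: edge_sign_def doubleton_eq_iff)

lemma edge_sign_flip:
  assumes "u \<notin> F h"
  shows "edge_sign \<gamma> {contraction F (u, x), contraction F (u, x + axis h 1)} =
         (if \<gamma> $ h = 1 then - 1 else 1)"
proof -
  let ?v = "contraction F (u, x)" and ?w = "contraction F (u, x + axis h 1)"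
  have "(\<exists>u' y z g. {?v, ?w} = {(u', y), (u', z)} \<and> differ_at g y z \<and> \<gamma> $ g = 1) \<longleftrightarrow> \<gamma> $ h = 1"
    (is "?l \<longleftrightarrow> ?r")
  proof
    assume ?l
    then obtain u' y z g
      where e: "{?v, ?w} = {(u', y), (u', z)}" and g: "differ_at g y z" "\<gamma> $ g = 1"
      by blast
    \<comment> \<open>The doubleton may match in either order; symmetry of \<open>differ_at\<close>
      covers both.\<close>
    from e g(1) have "differ_at g (snd ?v) (snd ?w)"
      by (auto simp: doubleton_eq_iff differ_at_commute)
    then show ?r
      using g(2) differ_at_contraction_flip[of u F h, OF assms] by simp
  next
    assume ?r
    moreover have "{?v, ?w} = {(u, snd ?v), (u, snd ?w)}"
      by (simp add: contraction_def)
    ultimately show ?l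
      using differ_at_contraction_flip[of u F h, OF assms] by blast
  qed
  then show ?thesis
    by (simp add: edge_sign_def)
qed

lemma other_end_eq:
  assumes "v \<noteq> w"
  shows "other_end {v, w} v = w"
  unfolding other_end_def using assms by (intro the_equality) (auto simp: doubleton_eq_iff)

section \<open>Extrusion graphs\<close>

lemma VP_extrusion_graph: "VP (extrusion_graph H F) = contraction F ` (VP H \<times> UNIV)"
  by (simp add: extrusion_graph_def cube_product_def)

lemma VH_extrusion_graph: "VH (extrusion_graph H F) = contraction F ` (VH H \<times> UNIV)"
  by (simp add: extrusion_graph_def cube_product_def)

lemma fst_VP_extrusion_graph: "v \<in> VP (extrusion_graph H F) \<Longrightarrow> fst v \<in> VP H"
  by (auto simp: VP_extrusion_graph)

lemma fst_VH_extrusion_graph: "v \<in> VH (extrusion_graph H F) \<Longrightarrow> fst v \<in> VH H"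
  by (auto simp: VH_extrusion_graph)

lemma extrude_VP: "v \<in> VP (extrusion_graph H F) \<Longrightarrow> extrude \<gamma> v \<in> VP (extrusion_graph H F)"
  by (auto simp: VP_extrusion_graph)

lemma extrude_VH: "v \<in> VH (extrusion_graph H F) \<Longrightarrow> extrude \<gamma> v \<in> VH (extrusion_graph H F)"
  by (auto simp: VH_extrusion_graph)

lemma extrude_VP_iff [simp]:
  "extrude \<gamma> v \<in> VP (extrusion_graph H F) \<longleftrightarrow> v \<in> VP (extrusion_graph H F)"
  by (metis extrude_VP extrude_extrude)

lemma extrude_VH_iff [simp]:
  "extrude \<gamma> v \<in> VH (extrusion_graph H F) \<longleftrightarrow> v \<in> VH (extrusion_graph H F)"
  by (metis extrude_VH extrude_extrude)

lemma cube_product_flip_edge: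
  assumes "u \<in> VP H \<union> VH H" and "differ_at h x y"
  shows "{(u, x), (u, y)} \<in> edges (cube_product H)"
  using assms unfolding cube_product_def by simp blast

lemma edges_extrusion_graphI:
  assumes "e \<in> edges (cube_product H)" "inj_on (contraction F) e"
  shows "contraction F ` e \<in> edges (extrusion_graph H F)"
  using assms by (auto simp: extrusion_graph_def)

text \<open>Contraction keeps the vertex of \<open>H\<close>, so a copy of an edge of
  \<open>H\<close> never collapses to a loop.\<close>

lemma transversal_edge:
  assumes "{u, v} \<in> edges H"
  shows "{contraction F (u, x), contraction F (v, x)} \<in> edges (extrusion_graph H F)"
proof -
  have "{(u, x), (v, x)} \<in> edges (cube_product H)"
    using assms by (auto simp: cube_product_def)
  moreover have "inj_on (contraction F) {(u, x), (v, x)}"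
    by (auto simp: inj_on_def contraction_def)
  ultimately have "contraction F ` {(u, x), (v, x)} \<in> edges (extrusion_graph H F)"
    by (rule edges_extrusion_graphI)
  then show ?thesis
    by simp
qed

lemma flip_edge:
  assumes "u \<in> VP H \<union> VH H" and "u \<notin> F h"
  shows "{contraction F (u, x), contraction F (u, x + axis h 1)} \<in> edges (extrusion_graph H F)"
proof -
  have "{(u, x), (u, x + axis h 1)} \<in> edges (cube_product H)"
    using cube_product_flip_edge[OF assms(1)] by (simp add: differ_at_bit)
  moreover have "inj_on (contraction F) {(u, x), (u, x + axis h 1)}"
    using assms(2) contraction_flip_eq_iff[of F u x h] by (auto simp: inj_on_def)
  ultimately have "contraction F ` {(u, x), (u, x + axis h 1)} \<in> edges (extrusion_graph H F)"
    by (rule edges_extrusion_graphI)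
  then show ?thesis
    by simp
qed

text \<open>A cube edge over \<open>u\<close> in direction \<open>h\<close> collapses exactly if
  \<open>u \<in> F h\<close>, so injectivity of the contraction on the edge yields
  \<open>u \<notin> F h\<close> in the second case.\<close>

lemma edge_extrusion_graphE:
  assumes "e \<in> edges (extrusion_graph H F)"
  obtains (transversal) u v x
    where "e = {contraction F (u, x), contraction F (v, x)}" "{u, v} \<in> edges H"
  | (flip) u x h
    where "e = {contraction F (u, x), contraction F (u, x + axis h 1)}"
      "u \<in> VP H \<union> VH H" "u \<notin> F h"
proof -
  from assms obtain e' where "e = contraction F ` e'" "inj_on (contraction F) e'"
    and "e' \<in> edges (cube_product H)"
    by (auto simp: extrusion_graph_def)
  then consider
      u v x where "e = contraction F ` {(u, x), (v, x)}" "{u, v} \<in> edges H"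
    | u x h where "e = contraction F ` {(u, x), (u, x + axis h 1)}" "u \<in> VP H \<union> VH H"
        "inj_on (contraction F) {(u, x), (u, x + axis h 1)}"
    by (auto simp: cube_product_def differ_at_bit)
  then show ?thesis
  proof cases
    case 1
    then show ?thesis
      using transversal[of u x v] by simp
  next
    case 2
    have "(u, x) \<noteq> (u, x + axis h (1::bit))"
      by (auto simp: Finite_Cartesian_Product.vec_eq_iff axis_def)
    then have "u \<notin> F h"
      using 2(3) contraction_flip_eq_iff[of F u x h] by (simp add: inj_on_def)
    then show ?thesis
      using flip[of u x h] 2(1,2) by simp
  qed
qed

lemma extrude_edge:
  assumes "e \<in> edges (extrusion_graph H F)"
  shows "extrude \<gamma> ` e \<in> edges (extrusion_graph H F)"
  using assms
proof (cases rule: edge_extrusion_graphE)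
  case (transversal u v x)
  then show ?thesis
    using transversal_edge[of u v H F "x + \<gamma>"] by simp
next
  case (flip u x h)
  have swap: "x + axis h 1 + \<gamma> = x + \<gamma> + axis h 1"
    by (simp add: ac_simps)
  show ?thesis
    using flip flip_edge[of u H F h "x + \<gamma>"] by (simp add: swap)
qed

lemma edge_extrusion_graph_cases:
  assumes "ph_graph H" and "{v, w} \<in> edges (extrusion_graph H F)"
  obtains (transversal) u u' x
    where "u \<noteq> u'" "v = contraction F (u, x)" "w = contraction F (u', x)"
  | (flip) u x h
    where "u \<notin> F h" "v = contraction F (u, x)" "w = contraction F (u, x + axis h 1)"
proof -
  from assms(2) show ?thesis
  proof (cases rule: edge_extrusion_graphE)
    case 1: (transversal u u' x)
    then have "card {u, u'} = 2"
      using assms(1) by (simp add: ph_graph_def)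
    then have "u \<noteq> u'"
      by auto
    then show ?thesis
      using 1(1) transversal[of u u' x] transversal[of u' u x] unfolding doubleton_eq_iff by blast
  next
    case 2: (flip u x h)
    \<comment> \<open>If the doubleton matches in reverse, the flip starts at the other end
      \<open>x + axis h 1\<close> instead, because the generator is an involution.\<close>
    from 2(1) consider
        "v = contraction F (u, x)" "w = contraction F (u, x + axis h 1)"
      | "v = contraction F (u, x + axis h 1)" "w = contraction F (u, x + axis h 1 + axis h 1)"
      unfolding bit_vec_double doubleton_eq_iff by blast
    then show ?thesis
      by cases (rule flip[OF 2(3)], assumption+)+
  qed
qed

section \<open>The action on the labels\<close>

fun extrude_row :: "bit ^ ('t::finite) \<Rightarrow> ('u, 't) xvertex row_label \<Rightarrow> ('u, 't) xvertex row_label"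
where
  "extrude_row \<gamma> (Row_PP e) = Row_PP (extrude \<gamma> ` e)"
| "extrude_row \<gamma> (Row_PH e) = Row_PH (extrude \<gamma> ` e)"
| "extrude_row \<gamma> (Row_HH_npar e) = Row_HH_npar (extrude \<gamma> ` e)"
| "extrude_row \<gamma> (Row_HH_par e m) = Row_HH_par (extrude \<gamma> ` e) m"
| "extrude_row \<gamma> (Row_VH k) = Row_VH (extrude \<gamma> k)"

fun row_sign :: "bit ^ ('t::finite) \<Rightarrow> ('u, 't) xvertex row_label \<Rightarrow> real" where
  "row_sign \<gamma> (Row_PP e) = edge_sign \<gamma> e"
| "row_sign \<gamma> (Row_HH_par e m) = edge_sign \<gamma> e"
| "row_sign \<gamma> _ = 1"

text \<open>The permutation matrix asks for \<open>r\<close> to be the image of \<open>r'\<close>;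
  as \<gamma> is an involution, this can be solved for \<open>r'\<close>. The sign is read off the
  edge of \<open>r\<close>.\<close>

lemma internal_entry_eq:
  "internal_entry \<gamma> r r' = (if r' = extrude_row \<gamma> r then row_sign \<gamma> r else 0)"
  by (cases r; cases r')
    (auto simp: signed_perm_entry_def perm_entry_def edge_sign_def)

lemma external_entry_Col_p:
  "external_entry \<tau> \<gamma> c (Col_p j n) = (if c = Col_p (extrude \<gamma> j) n then 1 else 0)"
  by (cases c) (auto simp: perm_entry_def)

lemma external_entry_Col_r:
  "external_entry \<tau> \<gamma> c (Col_r j) = (if c = Col_r (extrude \<gamma> j) then 1 else 0)"
  by (cases c) (auto simp: perm_entry_def)

text \<open>The second summand is the lower left corner of the nonzero block; its shift is taken at
  the row index, which is \<open>extrude \<gamma> j\<close>.\<close>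

lemma external_entry_Col_a:
  "external_entry \<tau> \<gamma> c (Col_a j n) =
     (if c = Col_a (extrude \<gamma> j) n then 1 else 0) +
     (if c = Col_r (extrude \<gamma> j) then - shift \<tau> \<gamma> (extrude \<gamma> j) $ n else 0)"
  by (cases c) (auto simp: perm_entry_def)

lemma affine_parallel_hyperplane:
  assumes "fst A \<noteq> 0" "fst B = fst A"
  shows "affine_parallel (hyperplane A) (hyperplane B)"
proof -
  \<comment> \<open>The multiple of the common normal that moves the offset of \<open>A\<close> to
    that of \<open>B\<close>; the normal is nonzero, so the division is legitimate.\<close>
  define v where "v = ((snd B - snd A) / (fst A \<bullet> fst A)) *\<^sub>R fst A"
  have v: "fst A \<bullet> v = snd B - snd A"
    using assms(1) by (simp add: v_def)
  have "x \<in> (\<lambda>x. v + x) ` hyperplane A" if "x \<in> hyperplane B" for x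
    using that v assms(2)
    by (intro image_eqI[of _ _ "x - v"]) (auto simp: hyperplane_def inner_diff_right)
  then have "hyperplane B = (\<lambda>x. v + x) ` hyperplane A"
    using v assms(2) by (auto simp: hyperplane_def inner_add_right)
  then show ?thesis
    unfolding affine_parallel_def by blast
qed

section \<open>Invariance of the rigidity matrix\<close>

locale extrusion_framework =
  fixes H :: "'u ph_graph"
    and F :: "'t::finite \<Rightarrow> 'u set"
    and G :: "('u, 't) xvertex ph_graph"
    and p :: "('u, 't) xvertex \<Rightarrow> real ^ 'd"
    and L :: "('u, 't) xvertex \<Rightarrow> (real ^ 'd) \<times> real"
    and \<tau> :: "'t \<Rightarrow> real ^ 'd"
  assumes G_def: "G = extrusion_graph H F"
    and H: "ph_graph H"
    and F: "F h \<subseteq> VH H"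
    and framework: "framework G p L"
    and symmetric: "extrusion_symmetric G F p L \<tau>"
begin

section \<open>Consequences of the symmetry and invariance of the edge classes\<close>

lemma p_extrude: "i \<in> VP G \<Longrightarrow> p (extrude \<gamma> i) = p i + shift \<tau> \<gamma> i"
  using symmetric by (simp add: extrusion_symmetric_def)

lemma normal_extrude: "j \<in> VH G \<Longrightarrow> fst (L (extrude \<gamma> j)) = fst (L j)"
  using symmetric by (simp add: extrusion_symmetric_def)

lemma normal_nonzero: "j \<in> VH G \<Longrightarrow> fst (L j) \<noteq> 0"
  using framework by (simp add: framework_def)

lemma G: "ph_graph G"
  using framework by (simp add: framework_def)

lemma VP_iff [simp]: "extrude \<gamma> v \<in> VP G \<longleftrightarrow> v \<in> VP G"
  by (simp add: G_def)

lemma VH_iff [simp]: "extrude \<gamma> v \<in> VH G \<longleftrightarrow> v \<in> VH G"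
  by (simp add: G_def)

text \<open>\<open>F h\<close> consists of hyperplane vertices, which are disjoint from the point
  vertices.\<close>

lemma point_unstarred: "v \<in> VP G \<Longrightarrow> fst v \<notin> F h"
  using fst_VP_extrusion_graph[of v H F] F[of h] H by (auto simp: G_def ph_graph_def)

lemma edge_ends:
  assumes "e \<in> edges G" "v \<in> e"
  obtains w where "e = {v, w}" "v \<noteq> w"
proof -
  have "card e = 2"
    using G assms(1) by (simp add: ph_graph_def)
  then show ?thesis
    using assms(2) that by (auto simp: card_2_iff)
qed

lemma extrude_edges: "e \<in> edges G \<Longrightarrow> extrude \<gamma> ` e \<in> edges G"
  unfolding G_def by (rule extrude_edge)

lemma other_end_extrude:
  assumes "e \<in> edges G" "v \<in> e"
  shows "other_end (extrude \<gamma> ` e) (extrude \<gamma> v) = extrude \<gamma> (other_end e v)"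
  using edge_ends[OF assms] by (metis extrude_eq_iff image_empty image_insert other_end_eq)

lemma other_end_mem:
  assumes "e \<in> edges G" "v \<in> e"
  shows "other_end e v \<in> e"
  using edge_ends[OF assms] by (metis insertCI other_end_eq)

lemma E_PP_extrude: "e \<in> E_PP G \<Longrightarrow> extrude \<gamma> ` e \<in> E_PP G"
  using extrude_edges[of e] by (auto simp: E_PP_def)

lemma E_PH_extrude: "e \<in> E_PH G \<Longrightarrow> extrude \<gamma> ` e \<in> E_PH G"
  using extrude_edges[of e] VP_iff VH_iff unfolding E_PH_def by blast

lemma E_HH_extrude: "e \<in> E_HH G \<Longrightarrow> extrude \<gamma> ` e \<in> E_HH G"
  using extrude_edges[of e] by (auto simp: E_HH_def)

text \<open>Extrusion preserves normals, so each hyperplane is parallel to its image; transitivity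
  transfers parallelism from the ends of \<open>e\<close> to those of its image.\<close>

lemma E_HH_par_extrude:
  assumes "e \<in> E_HH_par G L"
  shows "extrude \<gamma> ` e \<in> E_HH_par G L"
proof -
  have e: "e \<in> E_HH G"
    and par: "\<And>k l. e = {k, l} \<Longrightarrow> affine_parallel (hyperplane (L k)) (hyperplane (L l))"
    using assms by (auto simp: E_HH_par_def)
  have "affine_parallel (hyperplane (L k)) (hyperplane (L l))" if kl: "extrude \<gamma> ` e = {k, l}" for k l
  proof -
    have e': "e = {extrude \<gamma> k, extrude \<gamma> l}"
      by (metis kl extrude_image_image image_empty image_insert)
    then have VH: "k \<in> VH G" "l \<in> VH G"
      using e by (auto simp: E_HH_def)
    have "affine_parallel (hyperplane (L k)) (hyperplane (L (extrude \<gamma> k)))"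
      using VH by (simp add: affine_parallel_hyperplane normal_nonzero normal_extrude)
    moreover have "affine_parallel (hyperplane (L (extrude \<gamma> l))) (hyperplane (L l))"
      using VH by (simp add: affine_parallel_hyperplane normal_nonzero normal_extrude)
    ultimately show ?thesis
      using par[OF e'] affine_parallel_assoc by blast
  qed
  then show ?thesis
    using E_HH_extrude[OF e] by (auto simp: E_HH_par_def)
qed

text \<open>If the image were a parallel edge, applying \<gamma> again would make \<open>e\<close>
  parallel.\<close>

lemma E_HH_npar_extrude: "e \<in> E_HH_npar G L \<Longrightarrow> extrude \<gamma> ` e \<in> E_HH_npar G L"
  unfolding E_HH_npar_def using E_HH_extrude E_HH_par_extrude extrude_image_image
  by (metis DiffE DiffI)

lemma extrude_row_labels: "r \<in> row_labels G L \<Longrightarrow> extrude_row \<gamma> r \<in> row_labels G L"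
  by (cases r) (auto simp: row_labels_def E_PP_extrude E_PH_extrude E_HH_npar_extrude E_HH_par_extrude)

section \<open>Row identities for the separate edge types\<close>

lemma edge_cases:
  assumes "{v, w} \<in> edges G"
  obtains (transversal) u u' x
    where "u \<noteq> u'" "v = contraction F (u, x)" "w = contraction F (u', x)"
  | (flip) u x h
    where "u \<notin> F h" "v = contraction F (u, x)" "w = contraction F (u, x + axis h 1)"
  using edge_extrusion_graph_cases[OF H assms[unfolded G_def]] .

text \<open>On a copy of an edge of \<open>H\<close>, both ends move by the same vector. Along
  direction \<open>h\<close>, the difference is plus or minus \<open>\<tau> h\<close> according to
  the \<open>h\<close>-th bit, which \<gamma> changes exactly if \<open>\<gamma> $ h = 1\<close>;
  this is the edge sign.\<close>

lemma difference_extrude: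
  assumes "{v, w} \<in> E_PP G"
  shows "p v - p w = edge_sign \<gamma> {v, w} *\<^sub>R (p (extrude \<gamma> v) - p (extrude \<gamma> w))"
proof -
  have e: "{v, w} \<in> edges G" and VP: "v \<in> VP G" "w \<in> VP G"
    using assms by (auto simp: E_PP_def)
  from e show ?thesis
  proof (cases rule: edge_cases)
    case (transversal u u' x)
    have "shift \<tau> \<gamma> v = shift \<tau> \<gamma> w"
      using transversal point_unstarred[OF VP(1)] point_unstarred[OF VP(2)]
      by (simp add: shift_cong_unstarred)
    then show ?thesis
      using transversal VP by (simp add: p_extrude edge_sign_transversal del: extrude_contraction)
  next
    case (flip u x h)
    \<comment> \<open>The ends differ by the generator \<open>axis h 1\<close>, so the symmetry
      condition itself computes the difference, both at \<open>v\<close> and at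
      \<open>extrude \<gamma> v\<close>.\<close>
    have step: "p (extrude (axis h 1) i) - p i = shift \<tau> (axis h 1) i" if "i \<in> VP G" for i
      using that by (simp add: p_extrude)
    have "p w - p v = (if x $ h = 0 then \<tau> h else - \<tau> h)"
      using step[OF VP(1)] flip by (simp add: shift_axis)
    moreover have "p (extrude \<gamma> w) - p (extrude \<gamma> v) =
        (if (x + \<gamma>) $ h = 0 then \<tau> h else - \<tau> h)"
      using step[OF VP_iff[THEN iffD2, OF VP(1)], of \<gamma>] flip
      by (simp add: shift_axis add.assoc add.commute[of \<gamma>])
    moreover have "edge_sign \<gamma> {v, w} = (if \<gamma> $ h = 1 then - 1 else 1)"
      using flip by (simp add: edge_sign_flip)
    moreover have "(x + \<gamma>) $ h = 0 \<longleftrightarrow> (x $ h = 0 \<longleftrightarrow> \<gamma> $ h = 0)"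
      by (cases "x $ h"; cases "\<gamma> $ h") simp_all
    ultimately have "p w - p v = edge_sign \<gamma> {v, w} *\<^sub>R (p (extrude \<gamma> w) - p (extrude \<gamma> v))"
      by auto
    then show ?thesis
      by (metis minus_diff_eq scaleR_minus_right)
  qed
qed

text \<open>This makes the shift in the external representation match the displacement of the point
  in \<open>Row_PH\<close> rows. A star of \<open>k\<close> at \<open>h\<close> would make its
  normal orthogonal to \<open>\<tau> h\<close>, against \<open>no_dir\<close>.\<close>

lemma shift_PH:
  assumes no_dir: "\<nexists>i j h. {i, j} \<in> E_PH G \<and> i \<in> VP G \<and> j \<in> VH G \<and> contains_direction (L j) (\<tau> h)"
    and e: "{k, i} \<in> E_PH G" and k: "k \<in> VH G" and i: "i \<in> VP G"
  shows "shift \<tau> \<gamma> k = shift \<tau> \<gamma> i"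
proof -
  have "fst k \<notin> F h" for h
  proof
    assume "fst k \<in> F h"
    then have "contains_direction (L k) (\<tau> h)"
      using symmetric k by (simp add: extrusion_symmetric_def contains_direction_def inner_commute)
    then show False
      using no_dir e[unfolded insert_commute[of k]] k i by blast
  qed
  note unstarred = this point_unstarred[OF i]
  \<comment> \<open>Ends of different type lie over different vertices of \<open>H\<close>, which
    excludes edges along a generator.\<close>
  have types: "fst k \<noteq> fst i"
    using fst_VP_extrusion_graph[of i H F] fst_VH_extrusion_graph[of k H F] i k H
    by (auto simp: G_def ph_graph_def)
  have "{k, i} \<in> edges G"
    using e by (simp add: E_PH_def)
  then show ?thesis
  proof (cases rule: edge_cases)
    case (transversal u u' x)
    then show ?thesis
      using unstarred by (simp add: shift_cong_unstarred)
  next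
    case (flip u x h)
    then show ?thesis
      using types by simp
  qed
qed

lemma PH_other_end:
  assumes "e \<in> E_PH G" "v \<in> e"
  shows "v \<in> VP G \<Longrightarrow> other_end e v \<in> VH G" "v \<in> VH G \<Longrightarrow> other_end e v \<in> VP G"
proof -
  have "e \<in> edges G"
    using assms by (simp add: E_PH_def)
  then obtain w where "e = {v, w}" "v \<noteq> w"
    using assms(2) by (rule edge_ends)
  moreover have "VP G \<inter> VH G = {}"
    using G by (simp add: ph_graph_def)
  ultimately show "v \<in> VP G \<Longrightarrow> other_end e v \<in> VH G" "v \<in> VH G \<Longrightarrow> other_end e v \<in> VP G"
    using assms(1) by (auto simp: other_end_eq E_PH_def)
qed

text \<open>On copies of edges of \<open>H\<close>, the choice \<open>\<kappa>\<close> commutes with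
  \<gamma>. Along a generator the scalar is 1, so the two ends carry opposite vectors, and
  exchanging their roles is a change of sign.\<close>

lemma HH_par_entry_extrude:
  assumes conv: "parallel_conventions G L \<kappa> \<alpha>"
    and e: "e \<in> E_HH_par G L" and m: "m < CARD('d) - 1"
  shows "rigidity_entry p L \<kappa> \<alpha> (Row_HH_par e m) (Col_a v n) =
         edge_sign \<gamma> e *
         rigidity_entry p L \<kappa> \<alpha> (Row_HH_par (extrude \<gamma> ` e) m) (Col_a (extrude \<gamma> v) n)"
proof (cases "v \<in> e")
  case v: True
  define k where "k = \<kappa> e"
  define f where "f = extrude \<gamma> ` e"
  have f: "f \<in> E_HH_par G L"
    using E_HH_par_extrude[OF e] by (simp add: f_def)
  have edge: "e \<in> edges G" and VH: "e \<subseteq> VH G"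
    using e by (auto simp: E_HH_par_def E_HH_def)
  have k: "k \<in> e"
    using conv e by (simp add: parallel_conventions_def k_def)
  from edge_ends[OF edge k] obtain l where kl: "e = {k, l}" "k \<noteq> l" .
  have \<kappa>: "\<kappa> {k, l} = k"
    using k_def kl(1) by metis
  have f': "f = {extrude \<gamma> k, extrude \<gamma> l}"
    by (simp add: f_def kl)
  have \<alpha>: "\<alpha> f m = \<alpha> e m"
    using conv e m by (simp add: parallel_conventions_def f_def)
  have normals: "fst (L (extrude \<gamma> k)) = fst (L k)" "fst (L (extrude \<gamma> l)) = fst (L l)"
    using kl VH by (simp_all add: normal_extrude)
  have ends: "other_end e k = l" "other_end f (extrude \<gamma> k) = extrude \<gamma> l"
      "other_end f (extrude \<gamma> l) = extrude \<gamma> k"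
    using kl f' other_end_eq[of k l] other_end_eq[of "extrude \<gamma> k" "extrude \<gamma> l"]
      other_end_eq[of "extrude \<gamma> l" "extrude \<gamma> k"] by (simp_all add: insert_commute)
  have vkl: "v = k \<or> v = l"
    using v kl by simp
  have "{k, l} \<in> edges G"
    using edge kl by simp
  then show ?thesis
  proof (cases rule: edge_cases)
    case (transversal u u' x)
    \<comment> \<open>The orbit convention fixes the vertex of \<open>H\<close> below
      \<open>\<kappa> f\<close>; as the ends of \<open>f\<close> lie over distinct vertices, this
      determines \<open>\<kappa> f\<close>.\<close>
    have "inj_on fst e"
      using transversal kl by (auto simp: inj_on_def)
    then have "fst (\<kappa> f) = fst k"
      using conv e by (simp add: parallel_conventions_def f_def k_def)
    moreover have "\<kappa> f \<in> f"
      using conv f by (simp add: parallel_conventions_def)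
    ultimately have "\<kappa> f = extrude \<gamma> k"
      using transversal by (auto simp: f')
    moreover have "edge_sign \<gamma> e = 1"
      using transversal by (simp add: kl edge_sign_transversal)
    ultimately show ?thesis
      using vkl kl(2) \<alpha> normals ends by (auto simp: f_def[symmetric] \<kappa> kl(1) f')
  next
    case (flip u x h)
    \<comment> \<open>The convention for edges along a generator, restated for cube representatives:
      the end with entry 0 at \<open>h\<close> is chosen.\<close>
    have \<kappa>_eq: "\<kappa> {contraction F (u, y), contraction F (u, z)} = contraction F (u, y)"
      if "{contraction F (u, y), contraction F (u, z)} \<in> E_HH_par G L"
        "z = y + axis h 1" "y $ h = 0" for y z
    proof -
      have "{contraction F (u, y), contraction F (u, z)} =
          {(u, snd (contraction F (u, y))), (u, snd (contraction F (u, z)))}"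
        by (simp add: contraction_def)
      moreover have "differ_at h (snd (contraction F (u, y))) (snd (contraction F (u, z)))"
        using flip that differ_at_contraction_flip[of u F h h y] by simp
      moreover have "snd (contraction F (u, y)) $ h = Some 0" "snd (contraction F (u, z)) $ h = Some 1"
        using flip that by (simp_all add: contraction_def)
      ultimately have "\<kappa> {contraction F (u, y), contraction F (u, z)} = (u, snd (contraction F (u, y)))"
        using conv that(1) unfolding parallel_conventions_def by metis
      then show ?thesis
        by (simp add: contraction_def)
    qed
    \<comment> \<open>Since \<open>k\<close> is \<open>\<kappa> e\<close>, it must be the end with
      entry 0; otherwise the convention would select \<open>l\<close>.\<close>
    have x: "x $ h = 0"
    proof (rule ccontr)
      assume "x $ h \<noteq> 0"
      then have "(x + axis h 1) $ h = 0"
        by simp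
      then have "\<kappa> e = l"
        using \<kappa>_eq[of "x + axis h 1" x] flip e kl by (simp add: insert_commute)
      then show False
        using kl(2) k_def by simp
    qed
    have lk: "l = extrude (axis h 1) k"
      using flip by simp
    have "k \<in> VH G"
      using VH kl by simp
    then have eq: "fst (L l) = fst (L k)" and nz: "fst (L k) \<noteq> 0"
      by (simp_all only: lk normal_extrude normal_nonzero not_False_eq_True)
    \<comment> \<open>The ends have the same nonzero normal, so the scalar is uniquely determined
      and equals 1.\<close>
    then have c: "(THE c. fst (L k) = c *\<^sub>R fst (L k)) = 1"
      by (intro the_equality) (simp, metis scaleR_cancel_right scaleR_one)
    have sign: "edge_sign \<gamma> e = (if \<gamma> $ h = 1 then - 1 else 1)"
      using flip by (simp add: kl edge_sign_flip)
    \<comment> \<open>If \<open>\<gamma> $ h = 1\<close>, the entry 0 passes from the image of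
      \<open>k\<close> to that of \<open>l\<close>.\<close>
    have "\<kappa> f = (if \<gamma> $ h = 1 then extrude \<gamma> l else extrude \<gamma> k)"
    proof (cases "\<gamma> $ h = 1")
      case True
      have "\<kappa> {contraction F (u, x + axis h 1 + \<gamma>), contraction F (u, x + \<gamma>)} =
          contraction F (u, x + axis h 1 + \<gamma>)"
      proof (rule \<kappa>_eq)
        show "{contraction F (u, x + axis h 1 + \<gamma>), contraction F (u, x + \<gamma>)} \<in> E_HH_par G L"
          using f flip by (simp add: f' insert_commute)
        show "x + \<gamma> = x + axis h 1 + \<gamma> + axis h 1"
          by (simp add: Finite_Cartesian_Product.vec_eq_iff axis_def)
        show "(x + axis h 1 + \<gamma>) $ h = 0"
          using True x by simp
      qed
      then show ?thesis
        using True flip by (simp add: f' insert_commute)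
    next
      case False
      then show ?thesis
        using \<kappa>_eq[of "x + \<gamma>" "x + axis h 1 + \<gamma>"] flip f x
        by (simp add: f' ac_simps)
    qed
    then show ?thesis
      using vkl kl(2) \<alpha> normals ends c eq sign
      by (auto simp: f_def[symmetric] \<kappa> kl(1) f')
  qed
qed simp

section \<open>The three kinds of columns and the matrix identity\<close>

lemma entry_Col_p_extrude:
  assumes "r \<in> row_labels G L" "v \<in> VP G"
  shows "rigidity_entry p L \<kappa> \<alpha> r (Col_p v n) =
         row_sign \<gamma> r * rigidity_entry p L \<kappa> \<alpha> (extrude_row \<gamma> r) (Col_p (extrude \<gamma> v) n)"
proof (cases r)
  case (Row_PP e)
  then have e: "e \<in> E_PP G" "e \<in> edges G"
    using assms by (auto simp: row_labels_def E_PP_def)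
  show ?thesis
  proof (cases "v \<in> e")
    case True
    with e(2) obtain w where w: "e = {v, w}" "v \<noteq> w"
      by (rule edge_ends)
    have "other_end e v = w" "other_end (extrude \<gamma> ` e) (extrude \<gamma> v) = extrude \<gamma> w"
      using w by (simp_all add: other_end_eq)
    then show ?thesis
      using True Row_PP arg_cong[OF difference_extrude[OF e(1)[unfolded w(1)], of \<gamma>], of "\<lambda>z. z $ n"]
      by (simp add: w(1)[symmetric])
  qed (simp add: Row_PP)
next
  case (Row_PH e)
  then have e: "e \<in> E_PH G" "e \<in> edges G"
    using assms by (auto simp: row_labels_def E_PH_def)
  then show ?thesis
    using assms(2) Row_PH PH_other_end(1)[OF e(1)]
    by (auto simp: other_end_extrude normal_extrude)
qed simp_all

lemma entry_Col_r_extrude: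
  "rigidity_entry p L \<kappa> \<alpha> r (Col_r v) =
   row_sign \<gamma> r * rigidity_entry p L \<kappa> \<alpha> (extrude_row \<gamma> r) (Col_r (extrude \<gamma> v))"
  by (cases r) auto

text \<open>The left side is what the two nonzero entries of an external column leave of row
  \<open>r\<close>. In a \<open>Row_PH\<close> row through \<open>v\<close>, the entry at
  \<open>Col_r\<close> is -1, so the shift is added to the point and \<open>shift_PH\<close> gives
  the extruded point; in all other rows the correction vanishes.\<close>

lemma entry_Col_a_extrude:
  assumes no_dir: "\<nexists>i j h. {i, j} \<in> E_PH G \<and> i \<in> VP G \<and> j \<in> VH G \<and> contains_direction (L j) (\<tau> h)"
    and conv: "parallel_conventions G L \<kappa> \<alpha>"
    and r: "r \<in> row_labels G L" and v: "v \<in> VH G"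
  shows "rigidity_entry p L \<kappa> \<alpha> r (Col_a v n) -
           rigidity_entry p L \<kappa> \<alpha> r (Col_r v) * shift \<tau> \<gamma> v $ n =
         row_sign \<gamma> r * rigidity_entry p L \<kappa> \<alpha> (extrude_row \<gamma> r) (Col_a (extrude \<gamma> v) n)"
proof (cases r)
  case (Row_PH e)
  then have e: "e \<in> E_PH G" "e \<in> edges G"
    using r by (auto simp: row_labels_def E_PH_def)
  show ?thesis
  proof (cases "v \<in> e")
    case True
    have VP: "other_end e v \<in> VP G"
      using PH_other_end(2)[OF e(1) True v] .
    moreover have "e = {v, other_end e v}"
      using edge_ends[OF e(2) True] other_end_eq by metis
    ultimately have "shift \<tau> \<gamma> v = shift \<tau> \<gamma> (other_end e v)"
      using shift_PH[OF no_dir _ v] e(1) by metis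
    then show ?thesis
      using True Row_PH VP e by (simp add: other_end_extrude p_extrude)
  qed (simp add: Row_PH)
next
  case (Row_HH_npar e)
  then have "e \<in> edges G" "e \<subseteq> VH G"
    using r by (auto simp: row_labels_def E_HH_npar_def E_HH_def)
  then have "other_end e v \<in> VH G" if "v \<in> e"
    using that other_end_mem by blast
  then show ?thesis
    using Row_HH_npar \<open>e \<in> edges G\<close> by (simp add: other_end_extrude normal_extrude)
next
  case (Row_HH_par e m)
  then have "e \<in> E_HH_par G L" "m < CARD('d) - 1"
    using r by (auto simp: row_labels_def)
  from HH_par_entry_extrude[OF conv this] Row_HH_par show ?thesis
    by simp
next
  case (Row_VH k)
  then show ?thesis
    using r by (auto simp: row_labels_def normal_extrude)
qed simp

text \<open>An internal row leaves one term on the right; an external column leaves one term on the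
  left or, for \<open>Col_a\<close>, two. The entry-wise identities are then applied at
  \<open>extrude \<gamma> j\<close>, whose image under \<gamma> is \<open>j\<close>.\<close>

lemma rigidity_external_eq_internal_rigidity:
  assumes no_dir: "\<nexists>i j h. {i, j} \<in> E_PH G \<and> i \<in> VP G \<and> j \<in> VH G \<and> contains_direction (L j) (\<tau> h)"
    and conv: "parallel_conventions G L \<kappa> \<alpha>"
    and fin: "finite (row_labels G L)" "finite (col_labels G :: (('u, 't) xvertex, 'd) col_label set)"
    and r: "r \<in> row_labels G L" and c: "c \<in> col_labels G"
  shows "(\<Sum>c' \<in> col_labels G. rigidity_entry p L \<kappa> \<alpha> r c' * external_entry \<tau> \<gamma> c' c) =
         (\<Sum>r' \<in> row_labels G L. internal_entry \<gamma> r r' * rigidity_entry p L \<kappa> \<alpha> r' c)"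
proof -
  have "(\<Sum>r' \<in> row_labels G L. internal_entry \<gamma> r r' * rigidity_entry p L \<kappa> \<alpha> r' c) =
        (\<Sum>r' \<in> row_labels G L. if r' = extrude_row \<gamma> r
           then row_sign \<gamma> r * rigidity_entry p L \<kappa> \<alpha> r' c else 0)"
    by (intro sum.cong) (auto simp: internal_entry_eq)
  also have "\<dots> = row_sign \<gamma> r * rigidity_entry p L \<kappa> \<alpha> (extrude_row \<gamma> r) c"
    using fin r by (simp add: extrude_row_labels)
  also have "\<dots> = (\<Sum>c' \<in> col_labels G. rigidity_entry p L \<kappa> \<alpha> r c' * external_entry \<tau> \<gamma> c' c)"
  proof (cases c)
    case (Col_p j n)
    then have "j \<in> VP G"
      using c by (auto simp: col_labels_def)
    then have "Col_p (extrude \<gamma> j) n \<in> col_labels G"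
      unfolding col_labels_def using VP_iff by blast
    then show ?thesis
      using entry_Col_p_extrude[OF r, of "extrude \<gamma> j" \<kappa> \<alpha> n \<gamma>] \<open>j \<in> VP G\<close> fin
      by (simp add: Col_p external_entry_Col_p if_distrib cong: if_cong)
  next
    case (Col_a j n)
    then have "j \<in> VH G"
      using c by (auto simp: col_labels_def)
    then have "Col_a (extrude \<gamma> j) n \<in> col_labels G" "(Col_r (extrude \<gamma> j) :: (_, 'd) col_label) \<in> col_labels G"
      unfolding col_labels_def using VH_iff by blast+
    \<comment> \<open>The external column is a sum of two indicators, so the sum splits into one for
      each of the two labels.\<close>
    moreover have "(\<Sum>c' \<in> col_labels G. rigidity_entry p L \<kappa> \<alpha> r c' * external_entry \<tau> \<gamma> c' c) =
        (\<Sum>c' \<in> col_labels G. if c' = Col_a (extrude \<gamma> j) n then rigidity_entry p L \<kappa> \<alpha> r c' else 0) +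
        (\<Sum>c' \<in> col_labels G. if c' = Col_r (extrude \<gamma> j)
           then - rigidity_entry p L \<kappa> \<alpha> r c' * shift \<tau> \<gamma> (extrude \<gamma> j) $ n else 0)"
      unfolding sum.distrib[symmetric] Col_a external_entry_Col_a by (intro sum.cong) auto
    ultimately show ?thesis
      using entry_Col_a_extrude[OF no_dir conv r, of "extrude \<gamma> j" n \<gamma>] \<open>j \<in> VH G\<close> fin
      by (simp add: Col_a)
  next
    case (Col_r j)
    then have "(Col_r (extrude \<gamma> j) :: (_, 'd) col_label) \<in> col_labels G"
      using c by (auto simp: col_labels_def)
    then show ?thesis
      using entry_Col_r_extrude[of \<kappa> \<alpha> r "extrude \<gamma> j" \<gamma>] fin
      by (simp add: Col_r external_entry_Col_r if_distrib cong: if_cong)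
  qed
  finally show ?thesis ..
qed

end

theorem theorem3p3:
  fixes H :: "'u ph_graph"
    and F :: "'t::finite \<Rightarrow> 'u set"
    and G :: "('u, 't) xvertex ph_graph"
    and p :: "('u, 't) xvertex \<Rightarrow> real ^ 'd"
    and L :: "('u, 't) xvertex \<Rightarrow> (real ^ 'd) \<times> real"
    and \<tau> :: "'t \<Rightarrow> real ^ 'd"
    and \<kappa> :: "('u, 't) xvertex set \<Rightarrow> ('u, 't) xvertex"
    and \<alpha> :: "('u, 't) xvertex set \<Rightarrow> nat \<Rightarrow> real ^ 'd"
    and rs :: "('u, 't) xvertex row_label list"
    and cs :: "(('u, 't) xvertex, 'd) col_label list"
  defines "G \<equiv> extrusion_graph H F"
  assumes "ph_graph H"
    and "\<forall>h. F h \<subseteq> VH H"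
    and "framework G p L"
    and "extrusion_symmetric G F p L \<tau>"
    and "\<nexists>i j h. {i, j} \<in> E_PH G \<and> i \<in> VP G \<and> j \<in> VH G \<and> contains_direction (L j) (\<tau> h)"
    and "parallel_conventions G L \<kappa> \<alpha>"
    and "enumerates rs (row_labels G L)"
    and "enumerates cs (col_labels G)"
  shows "labelled_mat rs cs (rigidity_entry p L \<kappa> \<alpha>)
           \<in> Hom_rep (length cs) (\<lambda>\<gamma>. labelled_mat cs cs (external_entry \<tau> \<gamma>))
                     (length rs) (\<lambda>\<gamma>. labelled_mat rs rs (internal_entry \<gamma>))"
proof -
  interpret extrusion_framework H F G p L \<tau>
    using assms by unfold_locales auto
  have rs: "distinct rs" "set rs = row_labels G L" and cs: "distinct cs" "set cs = col_labels G"
    using assms by (simp_all add: enumerates_def)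
  \<comment> \<open>Finiteness of the label sets is inherited from the lists that enumerate
    them.\<close>
  then have fin: "finite (row_labels G L)" "finite (col_labels G :: (('u, 't) xvertex, 'd) col_label set)"
    by (metis finite_set)+
  have "labelled_mat rs cs (rigidity_entry p L \<kappa> \<alpha>) * labelled_mat cs cs (external_entry \<tau> \<gamma>) =
        labelled_mat rs rs (internal_entry \<gamma>) * labelled_mat rs cs (rigidity_entry p L \<kappa> \<alpha>)" for \<gamma>
    unfolding labelled_mat_mult[OF rs(1)] labelled_mat_mult[OF cs(1)] rs(2) cs(2)
    by (intro labelled_mat_cong rigidity_external_eq_internal_rigidity assms(6,7) fin)
      (simp_all add: rs cs)
  then show ?thesis
    by (simp add: Hom_rep_def labelled_mat_def)
qed

end
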